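(* Let $\Omega$ be a topological groupoid on $B$. Assume that for each $v\in B$ the map $\beta_v:\Omega_v\to B$, defined by $\beta_v(x)=\beta(x)$ for all $x\in\Omega_v$, is open. Let $\Omega'$ be a topological groupoid and let $F:\Omega\to\Omega'$ be a morphism (in the algebraic sense) which is continuous at every $\tilde u\in\tilde B$. Then $F$ is continuous everywhere on $\Omega$.
   Context: A groupoid $\Omega$ on a base $B$ has source projection $\alpha:\Omega\to B$, target projection $\beta:\Omega\to B$, object inclusion map $u\mapsto\tilde u$ from $B$ to $\Omega$, and a partial multiplication $xy$ defined exactly when $(x,y)\in\Omega*\Omega=\{(x,y)\in\Omega\times\Omega:\alpha(x)=\beta(y)\}$, with $\alpha(xy)=\alpha(y)$, $\beta(xy)=\beta(x)$, associativity, $\alpha(\tilde u)=\beta(\tilde u)=u$, $x\widetilde{\alpha(x)}=x$, $\widetilde{\beta(x)}x=x$, and two-sided inverses: $\alpha(x^{-1})=\beta(x)$, $\beta(x^{-1})=\alpha(x)$, $x^{-1}x=\widetilde{\alpha(x)}$, $xx^{-1}=\widetilde{\beta(x)}$. The base subgroupoid is $\tilde B=\{\tilde u:u\in B\}\subseteq\Omega$. For $v\in B$, $\Omega_v=\alpha^{-1}(\{v\})$, with the subspace topology from $\Omega$. A topological groupoid is a groupoid $\Omega$ on $B$ with topologies on $\Omega$ and $B$ such that $\alpha$, $\beta$, the object inclusion map, the inversion, and the partial multiplication (with $\Omega*\Omega$ carrying the subspace topology from $\Omega\times\Omega$) are continuous. A morphism (in the algebraic sense) $F:\Omega\to\Omega'$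 is a function such that for every composable pair $(x,y)\in\Omega*\Omega$ the pair $(F(x),F(y))$ is composable in $\Omega'$ and $F(xy)=F(x)F(y)$. *)

theory Defs
  imports "HOL-Analysis.Analysis"
begin

record ('g, 'b) groupoid_data =
  arrows :: "'g set"
  base :: "'b set"
  src :: "'g \<Rightarrow> 'b"
  tgt :: "'g \<Rightarrow> 'b"
  obj :: "'b \<Rightarrow> 'g"
  comp :: "'g \<Rightarrow> 'g \<Rightarrow> 'g"
  inverse_arrow :: "'g \<Rightarrow> 'g"

text \<open>The partial multiplication \<^const>\<open>comp\<close> is a total HOL function whose values are only
  meaningful on the set of composable pairs, where \<open>xy\<close> requires \<open>\<alpha>(x) = \<beta>(y)\<close>.\<close>

definition composable :: "('g, 'b) groupoid_data \<Rightarrow> ('g \<times> 'g) set" where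
  "composable G = {(x, y) \<in> arrows G \<times> arrows G. src G x = tgt G y}"

locale groupoid =
  fixes G :: "('g, 'b) groupoid_data"
  assumes src_closed: "x \<in> arrows G \<Longrightarrow> src G x \<in> base G"
    and tgt_closed: "x \<in> arrows G \<Longrightarrow> tgt G x \<in> base G"
    and obj_closed: "u \<in> base G \<Longrightarrow> obj G u \<in> arrows G"
    and comp_closed: "(x, y) \<in> composable G \<Longrightarrow> comp G x y \<in> arrows G"
    and inverse_closed: "x \<in> arrows G \<Longrightarrow> inverse_arrow G x \<in> arrows G"
    and src_comp: "(x, y) \<in> composable G \<Longrightarrow> src G (comp G x y) = src G y"
    and tgt_comp: "(x, y) \<in> composable G \<Longrightarrow> tgt G (comp G x y) = tgt G x"
    and comp_assoc: "(x, y) \<in> composable G \<Longrightarrow> (y, z) \<in> composable G \<Longrightarrow>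
      comp G (comp G x y) z = comp G x (comp G y z)"
    and src_obj: "u \<in> base G \<Longrightarrow> src G (obj G u) = u"
    and tgt_obj: "u \<in> base G \<Longrightarrow> tgt G (obj G u) = u"
    and comp_obj_right: "x \<in> arrows G \<Longrightarrow> comp G x (obj G (src G x)) = x"
    and comp_obj_left: "x \<in> arrows G \<Longrightarrow> comp G (obj G (tgt G x)) x = x"
    and src_inverse: "x \<in> arrows G \<Longrightarrow> src G (inverse_arrow G x) = tgt G x"
    and tgt_inverse: "x \<in> arrows G \<Longrightarrow> tgt G (inverse_arrow G x) = src G x"
    and inverse_left: "x \<in> arrows G \<Longrightarrow> comp G (inverse_arrow G x) x = obj G (src G x)"
    and inverse_right: "x \<in> arrows G \<Longrightarrow> comp G x (inverse_arrow G x) = obj G (tgt G x)"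

definition base_subgroupoid :: "('g, 'b) groupoid_data \<Rightarrow> 'g set" where
  "base_subgroupoid G = obj G ` base G"

definition src_fibre :: "('g, 'b) groupoid_data \<Rightarrow> 'b \<Rightarrow> 'g set" where
  "src_fibre G v = {x \<in> arrows G. src G x = v}"

locale topological_groupoid = groupoid G
  for G :: "('g, 'b) groupoid_data" +
  fixes X :: "'g topology" and Y :: "'b topology"
  assumes topspace_arrows: "topspace X = arrows G"
    and topspace_base: "topspace Y = base G"
    and continuous_src: "continuous_map X Y (src G)"
    and continuous_tgt: "continuous_map X Y (tgt G)"
    and continuous_obj: "continuous_map Y X (obj G)"
    and continuous_inverse: "continuous_map X X (inverse_arrow G)"
    and continuous_comp:
      "continuous_map (subtopology (prod_topology X X) (composable G)) X (\<lambda>(x, y). comp G x y)"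

definition groupoid_morphism ::
    "('g, 'b) groupoid_data \<Rightarrow> ('h, 'c) groupoid_data \<Rightarrow> ('g \<Rightarrow> 'h) \<Rightarrow> bool" where
  "groupoid_morphism G H F \<longleftrightarrow>
    F \<in> arrows G \<rightarrow> arrows H \<and>
    (\<forall>(x, y) \<in> composable G.
      (F x, F y) \<in> composable H \<and> F (comp G x y) = comp H (F x) (F y))"

end

theory Submission
  imports Defs
begin

text \<open>
  Continuity of \<open>F\<close> at an arbitrary arrow \<open>k : u \<rightarrow> v\<close> is reduced to continuity at the two
  units \<open>v\<^sup>~\<close> and \<open>u\<^sup>~\<close>. If an arrow \<open>g\<close> leads from \<open>u\<close> to the source of an arrow \<open>x\<close>, then
  \<open>x = (x g k\<inverse>) k g\<inverse>\<close>, and hence \<open>F x = F (x g k\<inverse>) F k F (g\<inverse>)\<close>.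
  When \<open>x\<close> is near \<open>k\<close> and \<open>g\<close> is near \<open>u\<^sup>~\<close>, the outer factors \<open>x g k\<inverse>\<close> and \<open>g\<inverse>\<close> are near
  \<open>v\<^sup>~\<close> and \<open>u\<^sup>~\<close>. So \<open>F x\<close> is near \<open>F (v\<^sup>~) F k F (u\<^sup>~) = F k\<close>, by continuity of \<open>F\<close> at
  the two units and of the multiplication in the target groupoid.

  In a topological group one would take \<open>g\<close> to be the unit. Here \<open>x\<close> may start at a point other
  than \<open>u\<close>, and a small \<open>g\<close> joining \<open>u\<close> to that point has to be found. The openness assumption
  supplies it: the targets of the arrows near \<open>u\<^sup>~\<close> that start at \<open>u\<close> form a
  neighbourhood of \<open>u\<close> in the base, and the source of \<open>x\<close> enters it as \<open>x\<close> approaches \<open>k\<close>.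
\<close>

lemma composable_iff:
  "(x, y) \<in> composable G \<longleftrightarrow> x \<in> arrows G \<and> y \<in> arrows G \<and> src G x = tgt G y"
  by (auto simp: composable_def)

context groupoid
begin

lemma comp_inverse_cancel_right:
  assumes "(x, y) \<in> composable G"
  shows "comp G (comp G x y) (inverse_arrow G y) = x"
proof -
  have y: "y \<in> arrows G" and x: "x \<in> arrows G" and st: "src G x = tgt G y"
    using assms by (auto simp: composable_iff)
  have "(y, inverse_arrow G y) \<in> composable G"
    using y by (simp add: composable_iff inverse_closed tgt_inverse)
  then have "comp G (comp G x y) (inverse_arrow G y) = comp G x (comp G y (inverse_arrow G y))"
    by (rule comp_assoc[OF assms])
  also have "\<dots> = x"
    using x y st by (metis inverse_right comp_obj_right)
  finally show ?thesis .
qed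

lemma comp_inverse_cancel_left:
  assumes "x \<in> arrows G" "y \<in> arrows G" "src G x = src G y"
  shows "comp G (comp G x (inverse_arrow G y)) y = x"
proof -
  have 1: "(x, inverse_arrow G y) \<in> composable G"
    and 2: "(inverse_arrow G y, y) \<in> composable G"
    using assms by (simp_all add: composable_iff inverse_closed tgt_inverse src_inverse)
  have "comp G (comp G x (inverse_arrow G y)) y = comp G x (comp G (inverse_arrow G y) y)"
    by (rule comp_assoc[OF 1 2])
  also have "\<dots> = x"
    using assms by (metis inverse_left comp_obj_right)
  finally show ?thesis .
qed

lemma inverse_obj:
  assumes "u \<in> base G"
  shows "inverse_arrow G (obj G u) = obj G u"
  using assms
  by (metis obj_closed src_obj tgt_obj inverse_closed src_inverse tgt_inverse
      inverse_right comp_obj_left)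

end

context topological_groupoid
begin

lemma comp_nhds:
  assumes xy: "(x, y) \<in> composable G" and W: "openin X W" and in_W: "comp G x y \<in> W"
  obtains U V where "openin X U" "openin X V" "x \<in> U" "y \<in> V"
    "\<And>a b. a \<in> U \<Longrightarrow> b \<in> V \<Longrightarrow> (a, b) \<in> composable G \<Longrightarrow> comp G a b \<in> W"
proof -
  let ?T = "subtopology (prod_topology X X) (composable G)"
  let ?P = "{p \<in> topspace ?T. (case p of (a, b) \<Rightarrow> comp G a b) \<in> W}"
  have topspace_T: "topspace ?T = composable G"
    by (auto simp: topspace_arrows composable_iff)
  have "openin ?T ?P"
    using openin_continuous_map_preimage[OF continuous_comp W] .
  then obtain S where S: "openin (prod_topology X X) S" "?P = S \<inter> composable G"
    by (auto simp: openin_subtopology)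
  have "(x, y) \<in> ?P"
    using xy in_W unfolding topspace_T by simp
  then have "(x, y) \<in> S"
    using S(2) by blast
  then obtain U V where UV: "openin X U" "openin X V" "x \<in> U" "y \<in> V" "U \<times> V \<subseteq> S"
    using openin_prod_topology_alt[THEN iffD1, OF S(1), rule_format] by metis
  have "comp G a b \<in> W" if "a \<in> U" "b \<in> V" "(a, b) \<in> composable G" for a b
  proof -
    have "(a, b) \<in> ?P"
      using that UV(5) S(2) by blast
    then show ?thesis
      by simp
  qed
  with UV(1-4) show thesis
    by (rule that)
qed

lemma comp3_nhds:
  assumes xy: "(x, y) \<in> composable G" and yz: "(y, z) \<in> composable G"
    and W: "openin X W" and in_W: "comp G (comp G x y) z \<in> W"
  obtains U V where "openin X U" "openin X V" "x \<in> U" "z \<in> V"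
    "\<And>a c. a \<in> U \<Longrightarrow> c \<in> V \<Longrightarrow> (a, y) \<in> composable G \<Longrightarrow> (y, c) \<in> composable G \<Longrightarrow>
      comp G (comp G a y) c \<in> W"
proof -
  have "(comp G x y, z) \<in> composable G"
    using xy yz by (simp add: composable_iff comp_closed src_comp)
  from comp_nhds[OF this W in_W]
  obtain P V where P: "openin X P" "openin X V" "comp G x y \<in> P" "z \<in> V"
    "\<And>p c. p \<in> P \<Longrightarrow> c \<in> V \<Longrightarrow> (p, c) \<in> composable G \<Longrightarrow> comp G p c \<in> W"
    by blast
  obtain U Q where U: "openin X U" "openin X Q" "x \<in> U" "y \<in> Q"
    "\<And>a b. a \<in> U \<Longrightarrow> b \<in> Q \<Longrightarrow> (a, b) \<in> composable G \<Longrightarrow> comp G a b \<in> P"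
    by (rule comp_nhds[OF xy P(1,3)]) blast
  have "comp G (comp G a y) c \<in> W"
    if "a \<in> U" "c \<in> V" "(a, y) \<in> composable G" "(y, c) \<in> composable G" for a c
  proof -
    have "(comp G a y, c) \<in> composable G"
      using that by (simp add: composable_iff comp_closed src_comp)
    then show ?thesis
      using that U P(5) by blast
  qed
  with U(1) P(2) U(3) P(4) show thesis
    by (rule that)
qed

end

text \<open>
  The arrow \<open>g\<close> is the device that corrects the source of \<open>x\<close>: it is chosen so close to the
  unit that \<open>x g k\<inverse>\<close> and \<open>g\<inverse>\<close> still lie in prescribed neighbourhoods of the units at the
  target and at the source of \<open>k\<close>. These two arrows are the factors \<open>p\<close> and \<open>q\<close>.
\<close>

lemma (in topological_groupoid) nearby_arrow_unit_factors:
  assumes fibre_open: "open_map (subtopology X (src_fibre G (src G k))) Y (tgt G)"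
    and k: "k \<in> arrows G"
    and U: "openin X U" "obj G (tgt G k) \<in> U"
    and V: "openin X V" "obj G (src G k) \<in> V"
  obtains N where "openin X N" "k \<in> N"
    "\<And>x. x \<in> N \<Longrightarrow> \<exists>p q. p \<in> U \<and> q \<in> V \<and> (p, k) \<in> composable G \<and> (k, q) \<in> composable G \<and>
      x = comp G (comp G p k) q"
proof -
  let ?u = "src G k" and ?k' = "inverse_arrow G k"
  have u: "?u \<in> base G" and k': "?k' \<in> arrows G"
    using k by (simp_all add: src_closed inverse_closed)
  have kk': "(k, ?k') \<in> composable G"
    using k k' by (simp add: composable_iff tgt_inverse)
  have kk'_U: "comp G k ?k' \<in> U"
    using k U(2) by (simp add: inverse_right)
  obtain P Q where P: "openin X P" "openin X Q" "k \<in> P" "?k' \<in> Q"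
    "\<And>a b. a \<in> P \<Longrightarrow> b \<in> Q \<Longrightarrow> (a, b) \<in> composable G \<Longrightarrow> comp G a b \<in> U"
    by (rule comp_nhds[OF kk' U(1) kk'_U]) blast
  have ku: "(k, obj G ?u) \<in> composable G"
    using k u by (simp add: composable_iff obj_closed tgt_obj)
  have ku_P: "comp G k (obj G ?u) \<in> P"
    using k P(3) by (simp add: comp_obj_right)
  obtain R S where R: "openin X R" "openin X S" "k \<in> R" "obj G ?u \<in> S"
    "\<And>a b. a \<in> R \<Longrightarrow> b \<in> S \<Longrightarrow> (a, b) \<in> composable G \<Longrightarrow> comp G a b \<in> P"
    by (rule comp_nhds[OF ku P(1) ku_P]) blast
  \<comment> \<open>\<open>?M\<close> collects the corrections \<open>g\<close> that are small enough; \<open>?D\<close> collects the base points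
    that such a \<open>g\<close> can reach from \<open>?u\<close>.\<close>
  let ?M = "S \<inter> {g \<in> topspace X. inverse_arrow G g \<in> V}"
  let ?D = "tgt G ` (?M \<inter> src_fibre G ?u)"
  have "openin X ?M"
    using R(2) openin_continuous_map_preimage[OF continuous_inverse V(1)] by blast
  then have D_open: "openin Y ?D"
    using fibre_open unfolding open_map_def by (metis openin_subtopology_Int)
  have "obj G ?u \<in> ?M \<inter> src_fibre G ?u"
    using u R(4) V(2)
    by (simp add: topspace_arrows obj_closed inverse_obj src_fibre_def src_obj)
  then have D_u: "?u \<in> ?D"
    by (rule rev_image_eqI) (simp add: u tgt_obj)
  let ?N = "R \<inter> {x \<in> topspace X. src G x \<in> ?D}"
  have "openin X ?N"
    using R(1) openin_continuous_map_preimage[OF continuous_src D_open] by blast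
  moreover have "k \<in> ?N"
    using R(3) k D_u by (simp add: topspace_arrows)
  moreover have "\<exists>p q. p \<in> U \<and> q \<in> V \<and> (p, k) \<in> composable G \<and> (k, q) \<in> composable G \<and>
      x = comp G (comp G p k) q" if "x \<in> ?N" for x
  proof -
    from that obtain g where g: "g \<in> S" "g \<in> arrows G" "inverse_arrow G g \<in> V"
        "src G g = ?u" "src G x = tgt G g"
      and x: "x \<in> R" "x \<in> arrows G"
      by (auto simp: topspace_arrows src_fibre_def)
    let ?p = "comp G (comp G x g) ?k'" and ?q = "inverse_arrow G g"
    have xg: "(x, g) \<in> composable G"
      using x g by (simp add: composable_iff)
    have xg_k': "(comp G x g, ?k') \<in> composable G"
      using xg k k' g by (simp add: composable_iff[of "comp G x g"] comp_closed src_comp tgt_inverse)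
    have "?p \<in> U"
      by (rule P(5)[OF R(5)[OF x(1) g(1) xg] P(4) xg_k'])
    moreover have "(?p, k) \<in> composable G"
      using xg_k' k by (simp add: composable_iff[of ?p] comp_closed src_comp src_inverse)
    moreover have "(k, ?q) \<in> composable G"
      using k g by (simp add: composable_iff inverse_closed tgt_inverse)
    moreover have "x = comp G (comp G ?p k) ?q"
    proof -
      have "comp G ?p k = comp G x g"
        using xg k g by (intro comp_inverse_cancel_left) (simp_all add: comp_closed src_comp)
      then show ?thesis
        using comp_inverse_cancel_right[OF xg] by simp
    qed
    ultimately show ?thesis
      using g(3) by blast
  qed
  ultimately show thesis
    by (rule that)
qed

lemma groupoid_morphismD:
  assumes "groupoid_morphism G H F" "(x, y) \<in> composable G"
  shows "(F x, F y) \<in> composable H" "F (comp G x y) = comp H (F x) (F y)"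
  using assms by (auto simp: groupoid_morphism_def)

lemma morphism_comp3:
  assumes "groupoid G" "groupoid_morphism G H F"
    and "(p, k) \<in> composable G" "(k, q) \<in> composable G"
  shows "F (comp G (comp G p k) q) = comp H (comp H (F p) (F k)) (F q)"
proof -
  interpret groupoid G by fact
  have "(comp G p k, q) \<in> composable G"
    using assms(3,4) by (simp add: composable_iff comp_closed src_comp)
  then show ?thesis
    using assms by (simp add: groupoid_morphismD)
qed

lemma topcontinuous_atE:
  assumes "topcontinuous_at X Y f x" "openin Y V" "f x \<in> V"
  obtains U where "openin X U" "x \<in> U" "\<And>y. y \<in> U \<Longrightarrow> f y \<in> V"
  using assms unfolding topcontinuous_at_def by metis

theorem theorem2:
  fixes \<Omega> :: "('g, 'b) groupoid_data" and X :: "'g topology" and B :: "'b topology"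
    and \<Omega>' :: "('h, 'c) groupoid_data" and X' :: "'h topology" and B' :: "'c topology"
    and F :: "'g \<Rightarrow> 'h"
  assumes "topological_groupoid \<Omega> X B"
    and "\<And>v. v \<in> base \<Omega> \<Longrightarrow> open_map (subtopology X (src_fibre \<Omega> v)) B (tgt \<Omega>)"
    and "topological_groupoid \<Omega>' X' B'"
    and "groupoid_morphism \<Omega> \<Omega>' F"
    and "\<And>e. e \<in> base_subgroupoid \<Omega> \<Longrightarrow> topcontinuous_at X X' F e"
  shows "continuous_map X X' F"
proof -
  interpret G: topological_groupoid \<Omega> X B by fact
  interpret H: topological_groupoid \<Omega>' X' B' by fact
  note mor = groupoid_morphismD[OF assms(4)]
  note mor3 = morphism_comp3[OF G.groupoid_axioms assms(4)]
  have F_arrows: "F x \<in> topspace X'" if "x \<in> topspace X" for x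
    using that assms(4) by (auto simp: groupoid_morphism_def G.topspace_arrows H.topspace_arrows)
  have "topcontinuous_at X X' F k" if "k \<in> topspace X" for k
    unfolding topcontinuous_at_def
  proof (intro conjI allI impI)
    show "k \<in> topspace X" by fact
    show "F \<in> topspace X \<rightarrow> topspace X'"
      using F_arrows by blast
    fix W
    assume W: "openin X' W \<and> F k \<in> W"
    have k: "k \<in> arrows \<Omega>"
      using that by (simp add: G.topspace_arrows)
    let ?s = "obj \<Omega> (src \<Omega> k)" and ?t = "obj \<Omega> (tgt \<Omega> k)"
    have units: "?s \<in> base_subgroupoid \<Omega>" "?t \<in> base_subgroupoid \<Omega>"
      using k by (simp_all add: base_subgroupoid_def G.src_closed G.tgt_closed)
    have tk: "(?t, k) \<in> composable \<Omega>" and ks: "(k, ?s) \<in> composable \<Omega>"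
      using k by (simp_all add: composable_iff G.obj_closed G.src_obj G.tgt_obj
          G.src_closed G.tgt_closed)
    have "comp \<Omega>' (comp \<Omega>' (F ?t) (F k)) (F ?s) = F k"
      using mor3[OF tk ks] k by (simp add: G.comp_obj_left G.comp_obj_right)
    then have in_W: "comp \<Omega>' (comp \<Omega>' (F ?t) (F k)) (F ?s) \<in> W"
      using W by simp
    obtain U' V' where U': "openin X' U'" "openin X' V'" "F ?t \<in> U'" "F ?s \<in> V'"
      "\<And>a c. a \<in> U' \<Longrightarrow> c \<in> V' \<Longrightarrow> (a, F k) \<in> composable \<Omega>' \<Longrightarrow> (F k, c) \<in> composable \<Omega>' \<Longrightarrow>
        comp \<Omega>' (comp \<Omega>' a (F k)) c \<in> W"
      by (rule H.comp3_nhds[OF mor(1)[OF tk] mor(1)[OF ks] conjunct1[OF W] in_W]) blast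
    obtain U where U: "openin X U" "?t \<in> U" "\<And>p. p \<in> U \<Longrightarrow> F p \<in> U'"
      by (rule topcontinuous_atE[OF assms(5)[OF units(2)] U'(1,3)]) blast
    obtain V where V: "openin X V" "?s \<in> V" "\<And>q. q \<in> V \<Longrightarrow> F q \<in> V'"
      by (rule topcontinuous_atE[OF assms(5)[OF units(1)] U'(2,4)]) blast
    obtain N where N: "openin X N" "k \<in> N"
      "\<And>x. x \<in> N \<Longrightarrow> \<exists>p q. p \<in> U \<and> q \<in> V \<and> (p, k) \<in> composable \<Omega> \<and> (k, q) \<in> composable \<Omega> \<and>
        x = comp \<Omega> (comp \<Omega> p k) q"
    proof (rule G.nearby_arrow_unit_factors
        [OF assms(2)[OF G.src_closed[OF k]] k U(1,2) V(1,2)])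
    qed (rule that)
    have "F x \<in> W" if "x \<in> N" for x
    proof -
      from N(3)[OF that] obtain p q where pq: "p \<in> U" "q \<in> V"
        "(p, k) \<in> composable \<Omega>" "(k, q) \<in> composable \<Omega>" "x = comp \<Omega> (comp \<Omega> p k) q"
        by blast
      show ?thesis
        unfolding pq(5) mor3[OF pq(3,4)]
        by (rule U'(5)[OF U(3)[OF pq(1)] V(3)[OF pq(2)] mor(1)[OF pq(3)] mor(1)[OF pq(4)]])
    qed
    then show "\<exists>U. openin X U \<and> k \<in> U \<and> (\<forall>y\<in>U. F y \<in> W)"
      using N by blast
  qed
  then show ?thesis
    by (simp add: continuous_map_eq_topcontinuous_at)
qed

end
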